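(* Let $G$ be a graph with no isolated vertex and let $H$ be a nontrivial graph. (i) If $\gamma(G)=\rho(G)$ and $\gamma_{\times 2}(H)=2$, then $\gamma_{\times 2}(G\circ H)=2\gamma(G)$. (ii) If $\gamma_{t\{R2\}}(G)\in \{\gamma_t(G),2\rho(G)\}$ and $\gamma(H)=1$, then $\gamma_{\times 2}(G\circ H)=\gamma_{t\{R2\}}(G)$. (iii) If $\gamma_{t\{R2\}}(G)=2\gamma_t(G)$ and $\gamma(H)\geq 2$, then $\gamma_{\times 2}(G\circ H)=\gamma_{t\{R2\}}(G)$.
   Context: All graphs are finite, undirected, without loops or multiple edges, and have at least one vertex; a graph is nontrivial if it has at least two vertices. $N(v)$ and $N[v]=N(v)\cup\{v\}$ denote the open and closed neighbourhoods of $v$. The lexicographic product $G\circ H$ has vertex set $V(G)\times V(H)$, and $(u,v)$ is adjacent to $(x,y)$ if and only if $ux\in E(G)$, or $u=x$ and $vy\in E(H)$. A vertex dominates itself and its neighbours. The domination number $\gamma(F)$ of a graph $F$ is the minimum cardinality of a set $S\subseteq V(F)$ such that every vertex of $F$ is dominated by at least one vertex of $S$. A $2$-packing of $F$ is a set $X\subseteq V(F)$ such that $N[u]\cap N[v]=\emptyset$ for every pair of different $u,v\in X$; $\rho(F)$ is the maximum cardinality of a $2$-packing. A double dominating set of $F$ is a set $S\subseteq V(F)$ such that every vertex of $F$ is dominated by at least two vertices of $S$ (it exists if and only if $F$ has no isolated vertex); $\gamma_{\times 2}(F)$ is the minimum cardinality of such a set, and the condition $\gamma_{\times 2}(H)=2$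 includes that $H$ has a double dominating set. For a graph $F$ with no isolated vertex: $\gamma_t(F)$ is the minimum cardinality of a total dominating set, i.e. a set $S\subseteq V(F)$ such that every vertex of $F$ (including those in $S$) has a neighbour in $S$; $\gamma_{t\{R2\}}(F)$ is the minimum of $\sum_{v\in V(F)}f(v)$ over all functions $f:V(F)\to\{0,1,2\}$ such that $\{v: f(v)\ge 1\}$ is a total dominating set of $F$ and $\sum_{w\in N(v)}f(w)\ge 2$ for every $v$ with $f(v)=0$. *)

theory Defs
  imports "Graph_Theory.Pair_Digraph"
begin

text \<open>
  A finite simple undirected graph is a \<^locale>\<open>pair_graph\<close>: a finite, loop-free, symmetric
  digraph whose arcs are ordered pairs of vertices. That locale admits the null graph, so
  non-emptiness of the vertex set is a separate requirement.
\<close>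

definition neighbourhood :: "'a pair_pre_digraph \<Rightarrow> 'a \<Rightarrow> 'a set" where
  "neighbourhood F v = {u. (v, u) \<in> parcs F}"

definition closed_neighbourhood :: "'a pair_pre_digraph \<Rightarrow> 'a \<Rightarrow> 'a set" where
  "closed_neighbourhood F v = insert v (neighbourhood F v)"

definition no_isolated_vertex :: "'a pair_pre_digraph \<Rightarrow> bool" where
  "no_isolated_vertex F \<longleftrightarrow> (\<forall>v \<in> pverts F. neighbourhood F v \<noteq> {})"

definition lex_product ::
    "'a pair_pre_digraph \<Rightarrow> 'b pair_pre_digraph \<Rightarrow> ('a \<times> 'b) pair_pre_digraph" where
  "lex_product G H =
    \<lparr> pverts = pverts G \<times> pverts H,
      parcs = {((u, v), (x, y)) | u v x y.
        u \<in> pverts G \<and> v \<in> pverts H \<and> x \<in> pverts G \<and> y \<in> pverts H \<and>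
        ((u, x) \<in> parcs G \<or> u = x \<and> (v, y) \<in> parcs H)} \<rparr>"

definition dominating_set :: "'a pair_pre_digraph \<Rightarrow> 'a set \<Rightarrow> bool" where
  "dominating_set F S \<longleftrightarrow>
    S \<subseteq> pverts F \<and> (\<forall>v \<in> pverts F. \<exists>u \<in> S. v \<in> closed_neighbourhood F u)"

definition domination_number :: "'a pair_pre_digraph \<Rightarrow> nat" where
  "domination_number F = (LEAST k. \<exists>S. dominating_set F S \<and> card S = k)"

definition two_packing :: "'a pair_pre_digraph \<Rightarrow> 'a set \<Rightarrow> bool" where
  "two_packing F X \<longleftrightarrow>
    X \<subseteq> pverts F \<and>
    (\<forall>u \<in> X. \<forall>v \<in> X. u \<noteq> v \<longrightarrow>
      closed_neighbourhood F u \<inter> closed_neighbourhood F v = {})"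

definition two_packing_number :: "'a pair_pre_digraph \<Rightarrow> nat" where
  "two_packing_number F = Max {card X | X. two_packing F X}"

definition double_dominating_set :: "'a pair_pre_digraph \<Rightarrow> 'a set \<Rightarrow> bool" where
  "double_dominating_set F S \<longleftrightarrow>
    S \<subseteq> pverts F \<and>
    (\<forall>v \<in> pverts F. 2 \<le> card {u \<in> S. v \<in> closed_neighbourhood F u})"

text \<open>
  The next three minima are meaningful only if an admissible set or function exists, i.e. if
  \<open>F\<close> has no isolated vertex; otherwise the value is unspecified. The lemmas at the end of this
  theory establish existence.
\<close>

definition double_domination_number :: "'a pair_pre_digraph \<Rightarrow> nat" where
  "double_domination_number F = (LEAST k. \<exists>S. double_dominating_set F S \<and> card S = k)"

definition total_dominating_set :: "'a pair_pre_digraph \<Rightarrow> 'a set \<Rightarrow> bool" where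
  "total_dominating_set F S \<longleftrightarrow>
    S \<subseteq> pverts F \<and> (\<forall>v \<in> pverts F. \<exists>u \<in> S. u \<in> neighbourhood F v)"

definition total_domination_number :: "'a pair_pre_digraph \<Rightarrow> nat" where
  "total_domination_number F = (LEAST k. \<exists>S. total_dominating_set F S \<and> card S = k)"

text \<open>
  Total Roman \<open>{2}\<close>-domination; values of \<open>f\<close> outside the vertex set are irrelevant.
\<close>

definition total_roman2_dominating_function ::
    "'a pair_pre_digraph \<Rightarrow> ('a \<Rightarrow> nat) \<Rightarrow> bool" where
  "total_roman2_dominating_function F f \<longleftrightarrow>
    f ` pverts F \<subseteq> {0, 1, 2} \<and>
    total_dominating_set F {v \<in> pverts F. 1 \<le> f v} \<and>
    (\<forall>v \<in> pverts F. f v = 0 \<longrightarrow> 2 \<le> (\<Sum>w \<in> neighbourhood F v. f w))"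

definition total_roman2_domination_number :: "'a pair_pre_digraph \<Rightarrow> nat" where
  "total_roman2_domination_number F =
    (LEAST k. \<exists>f. total_roman2_dominating_function F f \<and> (\<Sum>v \<in> pverts F. f v) = k)"

lemma pair_graph_lex_product:
  assumes "pair_graph G" "pair_graph H"
  shows "pair_graph (lex_product G H)"
proof -
  interpret G: pair_graph G by fact
  interpret H: pair_graph H by fact
  have fin: "finite (pverts G \<times> pverts H)"
    using G.pair_finite_verts H.pair_finite_verts by simp
  have sub: "parcs (lex_product G H) \<subseteq> (pverts G \<times> pverts H) \<times> (pverts G \<times> pverts H)"
    by (auto simp: lex_product_def)
  have "sym (parcs (lex_product G H))"
    using G.pair_sym_arcs H.pair_sym_arcs
    by (auto simp: lex_product_def symmetric_def sym_def)
  then show ?thesis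
    using sub fin finite_subset[OF sub] G.no_loops' H.no_loops'
    by unfold_locales (auto simp: lex_product_def symmetric_def)
qed

lemma no_isolated_vertex_lex_product:
  assumes "pair_graph G" "no_isolated_vertex G"
  shows "no_isolated_vertex (lex_product G H)"
proof -
  interpret G: pair_graph G by fact
  show ?thesis
    using assms(2) G.in_arcsD2
    unfolding no_isolated_vertex_def neighbourhood_def lex_product_def by fastforce
qed

lemma ex_double_dominating_set_iff:
  assumes "pair_graph F"
  shows "(\<exists>S. double_dominating_set F S) \<longleftrightarrow> no_isolated_vertex F"
proof -
  interpret F: pair_graph F by fact
  have sym: "(u, v) \<in> parcs F \<longleftrightarrow> (v, u) \<in> parcs F" for u v
    using F.pair_sym_arcs by (auto simp: symmetric_def sym_def)
  show ?thesis
  proof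
    assume "\<exists>S. double_dominating_set F S"
    then obtain S where S: "double_dominating_set F S" ..
    show "no_isolated_vertex F"
      unfolding no_isolated_vertex_def
    proof (intro ballI notI)
      fix v assume v: "v \<in> pverts F" and "neighbourhood F v = {}"
      then have "{u \<in> S. v \<in> closed_neighbourhood F u} \<subseteq> {v}"
        using sym by (auto simp: closed_neighbourhood_def neighbourhood_def)
      then have "card {u \<in> S. v \<in> closed_neighbourhood F u} \<le> card {v}"
        by (intro card_mono) auto
      with S v show False by (fastforce simp: double_dominating_set_def)
    qed
  next
    assume n: "no_isolated_vertex F"
    have "2 \<le> card {u \<in> pverts F. v \<in> closed_neighbourhood F u}" if v: "v \<in> pverts F" for v
    proof -
      from n v obtain w where w: "(v, w) \<in> parcs F"
        by (auto simp: no_isolated_vertex_def neighbourhood_def)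
      then have "{v, w} \<subseteq> {u \<in> pverts F. v \<in> closed_neighbourhood F u}"
        using v sym F.in_arcsD2 by (auto simp: closed_neighbourhood_def neighbourhood_def)
      then have "card {v, w} \<le> card {u \<in> pverts F. v \<in> closed_neighbourhood F u}"
        using F.pair_finite_verts by (intro card_mono) auto
      then show ?thesis using F.no_loops'[OF w] by simp
    qed
    then show "\<exists>S. double_dominating_set F S"
      by (auto simp: double_dominating_set_def intro!: exI[of _ "pverts F"])
  qed
qed

lemma total_dominating_set_pverts:
  assumes "pair_graph F" "no_isolated_vertex F"
  shows "total_dominating_set F (pverts F)"
proof -
  interpret F: pair_graph F by fact
  show ?thesis
    using assms(2) F.in_arcsD2
    by (fastforce simp: total_dominating_set_def no_isolated_vertex_def neighbourhood_def)
qed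

lemma total_roman2_dominating_function_const:
  assumes "pair_graph F" "no_isolated_vertex F"
  shows "total_roman2_dominating_function F (\<lambda>_. 2)"
  using total_dominating_set_pverts[OF assms]
  by (auto simp: total_roman2_dominating_function_def)

end

theory Submission
  imports Defs
begin

text \<open>
  Let \<open>S\<close> be a double dominating set of \<open>G \<circ> H\<close>, and let \<open>c u\<close> be the number of its vertices in the
  fibre over \<open>u\<close>. A vertex over \<open>u\<close> is dominated by everything over \<open>N(u)\<close> and by part of
  the fibre over \<open>u\<close>. Hence \<open>c\<close> has weight at least 2 on every closed neighbourhood, which gives
  \<open>2 \<rho>(G)\<close> as a lower bound. The support \<open>P\<close> of \<open>c\<close> may fail to be a total dominating set only at
  vertices \<open>u \<in> P\<close> isolated in \<open>P\<close>; there the fibre itself is a double dominating set of \<open>H\<close>, so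
  \<open>c u \<ge> \<gamma>(H) + 1\<close>. This surplus pays for adding a neighbour of \<open>u\<close> to \<open>P\<close>, and even, if
  \<open>\<gamma>(H) \<ge> 2\<close>, after \<open>c\<close> has been truncated at 2. The upper bounds come from explicit sets.
\<close>

section \<open>Neighbourhoods in a finite simple graph\<close>

lemma in_neighbourhood_sym:
  assumes "pair_graph F"
  shows "u \<in> neighbourhood F v \<longleftrightarrow> v \<in> neighbourhood F u"
proof -
  interpret pair_graph F by fact
  show ?thesis
    using pair_sym_arcs by (auto simp: neighbourhood_def symmetric_def sym_def)
qed

lemma neighbourhood_subset:
  assumes "pair_graph F"
  shows "neighbourhood F v \<subseteq> pverts F"
proof -
  interpret pair_graph F by fact
  show ?thesis
    using in_arcsD2 by (auto simp: neighbourhood_def)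
qed

lemma not_in_neighbourhood_self:
  assumes "pair_graph F"
  shows "v \<notin> neighbourhood F v"
proof -
  interpret pair_graph F by fact
  show ?thesis
    using no_loops' by (auto simp: neighbourhood_def)
qed

lemma finite_pverts:
  assumes "pair_graph F"
  shows "finite (pverts F)"
proof -
  interpret pair_graph F by fact
  show ?thesis
    by (rule pair_finite_verts)
qed

lemma finite_neighbourhood:
  assumes "pair_graph F"
  shows "finite (neighbourhood F v)"
  using neighbourhood_subset[OF assms] finite_pverts[OF assms] by (rule finite_subset)

section \<open>Extremal parameters: bounds and attainment\<close>

lemma domination_number_le: "dominating_set F S \<Longrightarrow> domination_number F \<le> card S"
  unfolding domination_number_def by (rule Least_le) blast

lemma domination_number_attained:
  obtains S where "dominating_set F S" "card S = domination_number F"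
proof -
  have "dominating_set F (pverts F)"
    by (auto simp: dominating_set_def closed_neighbourhood_def)
  then have "\<exists>k S. dominating_set F S \<and> card S = k"
    by blast
  from LeastI_ex[OF this] show ?thesis
    using that by (auto simp: domination_number_def)
qed

lemma two_packing_number_attained:
  assumes "pair_graph F"
  obtains X where "two_packing F X" "card X = two_packing_number F"
proof -
  have "{card X | X. two_packing F X} \<subseteq> card ` Pow (pverts F)"
    by (auto simp: two_packing_def)
  then have "finite {card X | X. two_packing F X}"
    by (rule finite_subset) (simp add: finite_pverts[OF assms])
  moreover have "two_packing F {}"
    by (simp add: two_packing_def)
  ultimately have "two_packing_number F \<in> {card X | X. two_packing F X}"
    unfolding two_packing_number_def by (intro Max_in) auto
  then show ?thesis
    using that by auto
qed

lemma double_domination_number_le: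
  "double_dominating_set F S \<Longrightarrow> double_domination_number F \<le> card S"
  unfolding double_domination_number_def by (rule Least_le) blast

lemma double_domination_number_attained:
  assumes "\<exists>S. double_dominating_set F S"
  obtains S where "double_dominating_set F S" "card S = double_domination_number F"
proof -
  have "\<exists>k S. double_dominating_set F S \<and> card S = k"
    using assms by blast
  from LeastI_ex[OF this] show ?thesis
    using that by (auto simp: double_domination_number_def)
qed

lemma total_domination_number_le:
  "total_dominating_set F S \<Longrightarrow> total_domination_number F \<le> card S"
  unfolding total_domination_number_def by (rule Least_le) blast

lemma total_domination_number_attained:
  assumes "pair_graph F" "no_isolated_vertex F"
  obtains S where "total_dominating_set F S" "card S = total_domination_number F"
proof -
  have "\<exists>k S. total_dominating_set F S \<and> card S = k"
    using total_dominating_set_pverts[OF assms] by blast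
  from LeastI_ex[OF this] show ?thesis
    using that by (auto simp: total_domination_number_def)
qed

lemma total_roman2_domination_number_le:
  "total_roman2_dominating_function F f \<Longrightarrow> total_roman2_domination_number F \<le> sum f (pverts F)"
  unfolding total_roman2_domination_number_def by (rule Least_le) blast

lemma total_roman2_domination_number_attained:
  assumes "pair_graph F" "no_isolated_vertex F"
  obtains f where "total_roman2_dominating_function F f"
    "sum f (pverts F) = total_roman2_domination_number F"
proof -
  have "\<exists>k f. total_roman2_dominating_function F f \<and> sum f (pverts F) = k"
    using total_roman2_dominating_function_const[OF assms] by blast
  from LeastI_ex[OF this] show ?thesis
    using that by (auto simp: total_roman2_domination_number_def)
qed

text \<open>Deleting a single vertex from a double dominating set takes at most one dominator away
  from each vertex, so the rest still dominates. Non-emptiness of the graph guarantees that there is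
  a vertex to delete.\<close>

lemma domination_number_less_card_double_dominating_set:
  assumes "pair_graph F" "pverts F \<noteq> {}" "double_dominating_set F C"
  shows "domination_number F < card C"
proof -
  have CF: "C \<subseteq> pverts F" and
    dd: "\<And>v. v \<in> pverts F \<Longrightarrow> 2 \<le> card {u \<in> C. v \<in> closed_neighbourhood F u}"
    using assms(3) by (auto simp: double_dominating_set_def)
  have fin: "finite C"
    using CF finite_pverts[OF assms(1)] by (rule finite_subset)
  obtain v where "v \<in> pverts F"
    using assms(2) by blast
  from dd[OF this] have "{u \<in> C. v \<in> closed_neighbourhood F u} \<noteq> {}"
    by fastforce
  then obtain a where a: "a \<in> C"
    by blast
  have "dominating_set F (C - {a})"
    unfolding dominating_set_def
  proof (intro conjI ballI)
    show "C - {a} \<subseteq> pverts F"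
      using CF by blast
  next
    fix v assume "v \<in> pverts F"
    have "\<not> {u \<in> C. v \<in> closed_neighbourhood F u} \<subseteq> {a}"
    proof
      assume "{u \<in> C. v \<in> closed_neighbourhood F u} \<subseteq> {a}"
      then have "card {u \<in> C. v \<in> closed_neighbourhood F u} \<le> card {a}"
        by (intro card_mono) auto
      with dd[OF \<open>v \<in> pverts F\<close>] show False
        by simp
    qed
    then show "\<exists>u \<in> C - {a}. v \<in> closed_neighbourhood F u"
      by blast
  qed
  then have "domination_number F \<le> card (C - {a})"
    by (rule domination_number_le)
  also have "\<dots> < card C"
    using fin a by (rule card_Diff1_less)
  finally show ?thesis .
qed

lemma domination_number_pos:
  assumes "pair_graph F" "pverts F \<noteq> {}"
  shows "1 \<le> domination_number F"
proof -
  obtain S where S: "dominating_set F S" "card S = domination_number F"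
    by (rule domination_number_attained)
  have "finite S"
    using S(1) finite_pverts[OF assms(1)] by (auto simp: dominating_set_def intro: finite_subset)
  moreover have "S \<noteq> {}"
    using S(1) assms(2) by (auto simp: dominating_set_def)
  ultimately have "0 < card S"
    by (simp add: card_gt_0_iff)
  then show ?thesis
    using S(2) by simp
qed

section \<open>Fibres and dominators in the lexicographic product\<close>

definition fibre :: "('a \<times> 'b) set \<Rightarrow> 'a \<Rightarrow> 'b set" where
  "fibre S u = {v. (u, v) \<in> S}"

lemma card_eq_sum_fibre:
  assumes "finite A" "finite S" "S \<subseteq> A \<times> B"
  shows "card S = (\<Sum>u \<in> A. card (fibre S u))"
proof -
  have "finite (fibre S u)" for u
    using finite_imageI[OF assms(2), of snd]
    by (rule finite_subset[rotated]) (force simp: fibre_def)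
  then have "card (Sigma A (fibre S)) = (\<Sum>u \<in> A. card (fibre S u))"
    using assms(1) by (intro card_SigmaI) auto
  moreover have "Sigma A (fibre S) = S"
    using assms(3) by (auto simp: fibre_def)
  ultimately show ?thesis
    by simp
qed

text \<open>A dominator of \<open>(u, v)\<close> in \<open>S\<close> lies either over a neighbour of
  \<open>u\<close>, where the second coordinate is arbitrary, or over \<open>u\<close> itself, where
  it must dominate \<open>v\<close> inside \<open>H\<close>. The two kinds are disjoint because
  \<open>u\<close> is not its own neighbour.\<close>

lemma card_dominators_lex_product:
  assumes G: "pair_graph G" and H: "pair_graph H" and S: "S \<subseteq> pverts G \<times> pverts H"
    and u: "u \<in> pverts G" and v: "v \<in> pverts H"
  shows "card {p \<in> S. (u, v) \<in> closed_neighbourhood (lex_product G H) p} =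
    (\<Sum>w \<in> neighbourhood G u. card (fibre S w)) +
    card {y \<in> fibre S u. v \<in> closed_neighbourhood H y}"
proof -
  let ?A = "Sigma (neighbourhood G u) (fibre S)"
  let ?B = "Pair u ` {y \<in> fibre S u. v \<in> closed_neighbourhood H y}"
  have "{p \<in> S. (u, v) \<in> closed_neighbourhood (lex_product G H) p} = ?A \<union> ?B"
    using S u v in_neighbourhood_sym[OF G] neighbourhood_subset[OF G, of u]
    by (fastforce simp: closed_neighbourhood_def neighbourhood_def lex_product_def fibre_def)
  moreover have "?A \<inter> ?B = {}"
    using not_in_neighbourhood_self[OF G] by auto
  moreover have fib: "finite (fibre S w)" for w
    by (rule finite_subset[OF _ finite_pverts[OF H]]) (use S in \<open>auto simp: fibre_def\<close>)
  moreover have "finite ?A"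
    using finite_neighbourhood[OF G] fib by (intro finite_SigmaI)
  ultimately have "card {p \<in> S. (u, v) \<in> closed_neighbourhood (lex_product G H) p} =
      card ?A + card ?B"
    by (simp add: card_Un_disjoint)
  moreover have "card ?A = (\<Sum>w \<in> neighbourhood G u. card (fibre S w))"
    using finite_neighbourhood[OF G] fib by (intro card_SigmaI) auto
  moreover have "card ?B = card {y \<in> fibre S u. v \<in> closed_neighbourhood H y}"
    by (intro card_image) (auto simp: inj_on_def)
  ultimately show ?thesis
    by simp
qed

text \<open>This reduces the product to weights on \<open>G\<close>: away from \<open>u\<close> only
  the fibre sizes count, and \<open>H\<close> enters solely through the fibre over \<open>u\<close>.
  All later bounds are derived from this form.\<close>

lemma double_dominating_set_lex_product_iff:
  assumes "pair_graph G" "pair_graph H"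
  shows "double_dominating_set (lex_product G H) S \<longleftrightarrow>
    S \<subseteq> pverts G \<times> pverts H \<and>
    (\<forall>u \<in> pverts G. \<forall>v \<in> pverts H.
      2 \<le> (\<Sum>w \<in> neighbourhood G u. card (fibre S w)) +
        card {y \<in> fibre S u. v \<in> closed_neighbourhood H y})"
proof -
  have "pverts (lex_product G H) = pverts G \<times> pverts H"
    by (simp add: lex_product_def)
  then show ?thesis
    using card_dominators_lex_product[OF assms, of S]
    by (auto simp: double_dominating_set_def)
qed

section \<open>Upper bounds from explicit double dominating sets\<close>

lemma double_domination_number_lex_product_le_mult:
  assumes G: "pair_graph G" and H: "pair_graph H" and ex: "\<exists>C. double_dominating_set H C"
  shows "double_domination_number (lex_product G H) \<le>
    domination_number G * double_domination_number H"
proof -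
  obtain D where D: "dominating_set G D" "card D = domination_number G"
    by (rule domination_number_attained)
  obtain C where C: "double_dominating_set H C" "card C = double_domination_number H"
    using ex by (rule double_domination_number_attained)
  have fC: "finite C"
    using C(1) finite_pverts[OF H] by (auto simp: double_dominating_set_def intro: finite_subset)
  \<comment> \<open>Let \<open>x\<close> in \<open>D\<close> dominate \<open>u\<close>. If
    \<open>x = u\<close>, the copy of \<open>C\<close> over \<open>u\<close> dominates doubly inside
    the fibre; otherwise the whole copy of \<open>C\<close> over \<open>x\<close> dominates
    \<open>(u, v)\<close>, and it has at least two elements.\<close>
  have "double_dominating_set (lex_product G H) (D \<times> C)"
    unfolding double_dominating_set_lex_product_iff[OF G H]
  proof (intro conjI ballI)
    show "D \<times> C \<subseteq> pverts G \<times> pverts H"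
      using C(1) D(1) by (auto simp: double_dominating_set_def dominating_set_def)
  next
    fix u v assume u: "u \<in> pverts G" and v: "v \<in> pverts H"
    have two: "2 \<le> card {y \<in> C. v \<in> closed_neighbourhood H y}"
      using C(1) v by (simp add: double_dominating_set_def)
    obtain x where x: "x \<in> D" "u \<in> closed_neighbourhood G x"
      using D(1) u by (auto simp: dominating_set_def)
    have fib: "fibre (D \<times> C) x = C"
      using x(1) by (auto simp: fibre_def)
    show "2 \<le> (\<Sum>w \<in> neighbourhood G u. card (fibre (D \<times> C) w)) +
        card {y \<in> fibre (D \<times> C) u. v \<in> closed_neighbourhood H y}"
    proof (cases "u = x")
      case True
      then show ?thesis
        using two fib by simp
    next
      case False
      then have "x \<in> neighbourhood G u"
        using x(2) in_neighbourhood_sym[OF G] by (auto simp: closed_neighbourhood_def)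
      then have "card C \<le> (\<Sum>w \<in> neighbourhood G u. card (fibre (D \<times> C) w))"
        using member_le_sum[of x "neighbourhood G u" "\<lambda>w. card (fibre (D \<times> C) w)"]
          finite_neighbourhood[OF G] fib by simp
      moreover have "2 \<le> card C"
        using two card_mono[OF fC, of "{y \<in> C. v \<in> closed_neighbourhood H y}"] by auto
      ultimately show ?thesis
        by linarith
    qed
  qed
  from double_domination_number_le[OF this] show ?thesis
    using D(2) C(2) by (simp add: card_cartesian_product)
qed

text \<open>Two copies of a minimum total dominating set of \<open>G\<close> suffice: some neighbour
  of \<open>u\<close> lies in \<open>T\<close>, and both vertices over it dominate everything over
  \<open>u\<close>.\<close>

lemma double_domination_number_lex_product_le_total:
  assumes G: "pair_graph G" "no_isolated_vertex G"
    and H: "pair_graph H" "2 \<le> card (pverts H)"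
  shows "double_domination_number (lex_product G H) \<le> 2 * total_domination_number G"
proof -
  obtain T where T: "total_dominating_set G T" "card T = total_domination_number G"
    using G by (rule total_domination_number_attained)
  obtain C where C: "C \<subseteq> pverts H" "card C = 2"
    using H(2) by (meson obtain_subset_with_card_n)
  have "double_dominating_set (lex_product G H) (T \<times> C)"
    unfolding double_dominating_set_lex_product_iff[OF G(1) H(1)]
  proof (intro conjI ballI)
    show "T \<times> C \<subseteq> pverts G \<times> pverts H"
      using C(1) T(1) by (auto simp: total_dominating_set_def)
  next
    fix u v assume u: "u \<in> pverts G" and v: "v \<in> pverts H"
    obtain x where x: "x \<in> T" "x \<in> neighbourhood G u"
      using T(1) u by (auto simp: total_dominating_set_def)
    then have "fibre (T \<times> C) x = C"
      by (auto simp: fibre_def)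
    then show "2 \<le> (\<Sum>w \<in> neighbourhood G u. card (fibre (T \<times> C) w)) +
        card {y \<in> fibre (T \<times> C) u. v \<in> closed_neighbourhood H y}"
      using member_le_sum[of x "neighbourhood G u" "\<lambda>w. card (fibre (T \<times> C) w)"]
        finite_neighbourhood[OF G(1)] x(2) C(2) by simp
  qed
  from double_domination_number_le[OF this] show ?thesis
    using T(2) C(2) by (simp add: card_cartesian_product mult.commute)
qed

text \<open>An optimal \<open>f\<close> is realised as a function of fibre sizes. Where
  \<open>f u = 0\<close>, the neighbouring fibres supply two dominators; elsewhere total domination
  supplies one from outside and a universal vertex of \<open>H\<close> supplies one inside the
  fibre.\<close>

lemma double_domination_number_lex_product_le_roman:
  assumes G: "pair_graph G" "no_isolated_vertex G"
    and H: "pair_graph H" "2 \<le> card (pverts H)" "domination_number H = 1"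
  shows "double_domination_number (lex_product G H) \<le> total_roman2_domination_number G"
proof -
  obtain f where f: "total_roman2_dominating_function G f"
    "sum f (pverts G) = total_roman2_domination_number G"
    using G by (rule total_roman2_domination_number_attained)
  obtain D where "dominating_set H D" "card D = 1"
    using domination_number_attained[of H] H(3) by metis
  then obtain h where h: "h \<in> pverts H" "\<And>v. v \<in> pverts H \<Longrightarrow> v \<in> closed_neighbourhood H h"
    by (auto simp: dominating_set_def card_1_singleton_iff)
  have "\<not> pverts H \<subseteq> {h}"
  proof
    assume "pverts H \<subseteq> {h}"
    then have "card (pverts H) \<le> card {h}"
      by (intro card_mono) auto
    with H(2) show False
      by simp
  qed
  then obtain h' where h': "h' \<in> pverts H" "h' \<noteq> h"
    by blast
  \<comment> \<open>Every nonempty fibre contains the universal vertex \<open>h\<close>; the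
    arbitrary second vertex \<open>h'\<close> only brings the fibre to size 2.\<close>
  define S where "S = (\<Union>u \<in> pverts G.
    {u} \<times> (if f u = 0 then {} else if f u = 1 then {h} else {h, h'}))"
  have fle: "f u \<in> {0, 1, 2}" if "u \<in> pverts G" for u
    using f(1) that unfolding total_roman2_dominating_function_def by blast
  have fib: "fibre S u = (if f u = 0 then {} else if f u = 1 then {h} else {h, h'})"
    if "u \<in> pverts G" for u
    using that by (auto simp: S_def fibre_def)
  have cfib: "card (fibre S u) = f u" if "u \<in> pverts G" for u
    using fle[OF that] fib[OF that] h'(2) by auto
  have Ssub: "S \<subseteq> pverts G \<times> pverts H"
    using h(1) h'(1) by (auto simp: S_def split: if_splits)
  have sumfib: "(\<Sum>w \<in> neighbourhood G u. card (fibre S w)) = sum f (neighbourhood G u)" for u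
    using neighbourhood_subset[OF G(1), of u] cfib by (intro sum.cong) auto
  have "double_dominating_set (lex_product G H) S"
    unfolding double_dominating_set_lex_product_iff[OF G(1) H(1)] sumfib
  proof (intro conjI ballI Ssub)
    fix u v assume u: "u \<in> pverts G" and v: "v \<in> pverts H"
    show "2 \<le> sum f (neighbourhood G u) + card {y \<in> fibre S u. v \<in> closed_neighbourhood H y}"
    proof (cases "f u = 0")
      case True
      then have "2 \<le> sum f (neighbourhood G u)"
        using f(1) u by (simp add: total_roman2_dominating_function_def)
      then show ?thesis
        by simp
    next
      case False
      obtain x where x: "x \<in> neighbourhood G u" "1 \<le> f x"
        using f(1) u by (auto simp: total_roman2_dominating_function_def total_dominating_set_def)
      then have "1 \<le> sum f (neighbourhood G u)"
        using member_le_sum[of x "neighbourhood G u" f] finite_neighbourhood[OF G(1)] by simp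
      moreover have "h \<in> {y \<in> fibre S u. v \<in> closed_neighbourhood H y}"
        using False fib[OF u] h(2)[OF v] by simp
      moreover have "finite {y \<in> fibre S u. v \<in> closed_neighbourhood H y}"
        using fib[OF u] by simp
      ultimately have "1 \<le> card {y \<in> fibre S u. v \<in> closed_neighbourhood H y}"
        by (metis One_nat_def Suc_leI card_gt_0_iff empty_iff)
      then show ?thesis
        using \<open>1 \<le> sum f (neighbourhood G u)\<close> by simp
    qed
  qed
  then have "double_domination_number (lex_product G H) \<le> card S"
    by (rule double_domination_number_le)
  also have "card S = (\<Sum>u \<in> pverts G. card (fibre S u))"
    using finite_pverts[OF G(1)] finite_pverts[OF H(1)] Ssub
    by (intro card_eq_sum_fibre) (auto intro: finite_subset)
  also have "\<dots> = total_roman2_domination_number G"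
    using cfib f(2) by simp
  finally show ?thesis .
qed

section \<open>Lower bounds from fibre sizes\<close>

text \<open>Here \<open>c u\<close> is the fibre size of a minimum double dominating set. The lemma
  collects the facts about it on which every lower bound rests, so that the product itself
  disappears from view. If the neighbours of \<open>u\<close> carry no weight, both dominators of
  each vertex over \<open>u\<close> lie in its own fibre.\<close>

lemma fibre_weight_lex_product:
  assumes G: "pair_graph G" "no_isolated_vertex G"
    and H: "pair_graph H" "pverts H \<noteq> {}"
  obtains c where "double_domination_number (lex_product G H) = sum c (pverts G)"
    and "\<And>u. u \<in> pverts G \<Longrightarrow> 2 \<le> sum c (closed_neighbourhood G u)"
    and "\<And>u. u \<in> pverts G \<Longrightarrow> sum c (neighbourhood G u) = 0 \<Longrightarrow> domination_number H < c u"
proof -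
  have "\<exists>S. double_dominating_set (lex_product G H) S"
    using ex_double_dominating_set_iff pair_graph_lex_product[OF G(1) H(1)]
      no_isolated_vertex_lex_product[OF G] by blast
  then obtain S where S: "double_dominating_set (lex_product G H) S"
    "card S = double_domination_number (lex_product G H)"
    by (rule double_domination_number_attained)
  then have Ssub: "S \<subseteq> pverts G \<times> pverts H" and
    two: "\<And>u v. u \<in> pverts G \<Longrightarrow> v \<in> pverts H \<Longrightarrow>
      2 \<le> (\<Sum>w \<in> neighbourhood G u. card (fibre S w)) +
        card {y \<in> fibre S u. v \<in> closed_neighbourhood H y}"
    by (auto simp: double_dominating_set_lex_product_iff[OF G(1) H(1)])
  have fibsub: "fibre S u \<subseteq> pverts H" for u
    using Ssub by (auto simp: fibre_def)
  have fib: "finite (fibre S u)" for u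
    using fibsub finite_pverts[OF H(1)] by (rule finite_subset)
  let ?c = "\<lambda>u. card (fibre S u)"
  show ?thesis
  proof (rule that[of ?c])
    have "card S = sum ?c (pverts G)"
      using finite_pverts[OF G(1)] finite_pverts[OF H(1)] Ssub
      by (intro card_eq_sum_fibre) (auto intro: finite_subset)
    then show "double_domination_number (lex_product G H) = sum ?c (pverts G)"
      using S(2) by simp
  next
    fix u assume u: "u \<in> pverts G"
    obtain v where v: "v \<in> pverts H"
      using H(2) by blast
    have "card {y \<in> fibre S u. v \<in> closed_neighbourhood H y} \<le> ?c u"
      using fib by (intro card_mono) auto
    then have "2 \<le> sum ?c (neighbourhood G u) + ?c u"
      using two[OF u v] by linarith
    then show "2 \<le> sum ?c (closed_neighbourhood G u)"
      using finite_neighbourhood[OF G(1)] not_in_neighbourhood_self[OF G(1)]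
      by (simp add: closed_neighbourhood_def)
  next
    fix u assume u: "u \<in> pverts G" and 0: "sum ?c (neighbourhood G u) = 0"
    have "double_dominating_set H (fibre S u)"
      unfolding double_dominating_set_def using fibsub two[OF u, unfolded 0] by simp
    then show "domination_number H < ?c u"
      by (rule domination_number_less_card_double_dominating_set[OF H])
  qed
qed

lemma two_packing_number_le_double_domination_number_lex_product:
  assumes G: "pair_graph G" "no_isolated_vertex G"
    and H: "pair_graph H" "pverts H \<noteq> {}"
  shows "2 * two_packing_number G \<le> double_domination_number (lex_product G H)"
proof -
  obtain X where X: "two_packing G X" "card X = two_packing_number G"
    using G(1) by (rule two_packing_number_attained)
  obtain c where c: "double_domination_number (lex_product G H) = sum c (pverts G)"
    "\<And>u. u \<in> pverts G \<Longrightarrow> 2 \<le> sum c (closed_neighbourhood G u)"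
    using fibre_weight_lex_product[OF assms] by metis
  have XG: "X \<subseteq> pverts G"
    using X(1) by (simp add: two_packing_def)
  have fin: "finite X"
    using XG finite_pverts[OF G(1)] by (rule finite_subset)
  have "2 * card X \<le> (\<Sum>u \<in> X. sum c (closed_neighbourhood G u))"
    using sum_bounded_below[of X 2 "\<lambda>u. sum c (closed_neighbourhood G u)"] c(2) XG
    by (auto simp: mult.commute)
  \<comment> \<open>The closed neighbourhoods of the vertices of a 2-packing are pairwise disjoint,
    so no weight is counted twice.\<close>
  also have "\<dots> = sum c (\<Union>u \<in> X. closed_neighbourhood G u)"
    using X(1) finite_neighbourhood[OF G(1)] fin
    by (intro sum.UNION_disjoint[symmetric]) (auto simp: two_packing_def closed_neighbourhood_def)
  also have "\<dots> \<le> sum c (pverts G)"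
    using XG neighbourhood_subset[OF G(1)] finite_pverts[OF G(1)]
    by (intro sum_mono2) (auto simp: closed_neighbourhood_def)
  finally show ?thesis
    using X(2) c(1) by simp
qed

text \<open>A vertex whose open neighbourhood has positive weight already has a neighbour in the
  support. For each remaining vertex one chosen neighbour is added; the bound on
  \<open>card J\<close> is the cost that the surplus weight has to cover.\<close>

lemma total_dominating_set_extend_support:
  fixes c :: "'a \<Rightarrow> nat"
  assumes G: "pair_graph G" "no_isolated_vertex G"
    and dom: "\<And>u. u \<in> pverts G \<Longrightarrow> 2 \<le> sum c (closed_neighbourhood G u)"
  obtains J where "J \<subseteq> pverts G"
    "total_dominating_set G ({u \<in> pverts G. 1 \<le> c u} \<union> J)"
    "card J \<le> card {u \<in> pverts G. sum c (neighbourhood G u) = 0}"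
proof -
  let ?I = "{u \<in> pverts G. sum c (neighbourhood G u) = 0}"
  obtain g where g: "\<And>u. u \<in> pverts G \<Longrightarrow> g u \<in> neighbourhood G u"
    using bchoice[of "pverts G" "\<lambda>u w. w \<in> neighbourhood G u"] G(2)
    unfolding no_isolated_vertex_def by blast
  show ?thesis
  proof (rule that[of "g ` ?I"])
    show sub: "g ` ?I \<subseteq> pverts G"
      using g neighbourhood_subset[OF G(1)] by blast
    show "card (g ` ?I) \<le> card ?I"
      using finite_pverts[OF G(1)] by (intro card_image_le) simp
    show "total_dominating_set G ({u \<in> pverts G. 1 \<le> c u} \<union> g ` ?I)"
      unfolding total_dominating_set_def
    proof (intro conjI ballI)
      show "{u \<in> pverts G. 1 \<le> c u} \<union> g ` ?I \<subseteq> pverts G"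
        using sub by blast
    next
      fix v assume v: "v \<in> pverts G"
      show "\<exists>u \<in> {u \<in> pverts G. 1 \<le> c u} \<union> g ` ?I. u \<in> neighbourhood G v"
      proof (cases "sum c (neighbourhood G v) = 0")
        case True
        then show ?thesis
          using g[OF v] v by blast
      next
        case False
        then obtain u where "u \<in> neighbourhood G v" "c u \<noteq> 0"
          by (metis sum.neutral)
        then show ?thesis
          using neighbourhood_subset[OF G(1)] by fastforce
      qed
    qed
  qed
qed

text \<open>The accounting device for both bounds below: a surplus of one unit at each vertex
  satisfying \<open>P\<close> pays for one extra vertex.\<close>

lemma sum_add_card_le:
  fixes a b :: "'a \<Rightarrow> nat"
  assumes "finite A" "\<And>u. u \<in> A \<Longrightarrow> a u + (if P u then 1 else 0) \<le> b u"
  shows "sum a A + card {u \<in> A. P u} \<le> sum b A"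
proof -
  have "sum a A + card {u \<in> A. P u} = (\<Sum>u \<in> A. a u + (if P u then 1 else 0))"
    using assms(1) by (simp add: sum.distrib flip: sum.inter_filter)
  also have "\<dots> \<le> sum b A"
    using assms(2) by (rule sum_mono)
  finally show ?thesis .
qed

lemma total_domination_number_le_double_domination_number_lex_product:
  assumes G: "pair_graph G" "no_isolated_vertex G"
    and H: "pair_graph H" "pverts H \<noteq> {}"
  shows "total_domination_number G \<le> double_domination_number (lex_product G H)"
proof -
  obtain c where c: "double_domination_number (lex_product G H) = sum c (pverts G)"
    "\<And>u. u \<in> pverts G \<Longrightarrow> 2 \<le> sum c (closed_neighbourhood G u)"
    "\<And>u. u \<in> pverts G \<Longrightarrow> sum c (neighbourhood G u) = 0 \<Longrightarrow> domination_number H < c u"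
    using fibre_weight_lex_product[OF assms] by metis
  let ?P = "{u \<in> pverts G. 1 \<le> c u}" and ?I = "{u \<in> pverts G. sum c (neighbourhood G u) = 0}"
  obtain J where "J \<subseteq> pverts G" and J: "total_dominating_set G (?P \<union> J)" "card J \<le> card ?I"
    by (rule total_dominating_set_extend_support[OF G c(2)])
  have "total_domination_number G \<le> card (?P \<union> J)"
    using J(1) by (rule total_domination_number_le)
  also have "\<dots> \<le> card ?P + card ?I"
    using J(2) card_Un_le[of ?P J] by linarith
  also have "card ?P = (\<Sum>u \<in> pverts G. if 1 \<le> c u then 1 else 0)"
    using finite_pverts[OF G(1)] by (simp flip: sum.inter_filter)
  \<comment> \<open>On \<open>?I\<close> the weight exceeds \<open>domination_number H\<close>,
    hence is at least 2: one unit counts the vertex in \<open>?P\<close>, the other pays for its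
    added neighbour.\<close>
  also have "\<dots> + card ?I \<le> sum c (pverts G)"
    using finite_pverts[OF G(1)] c(3) domination_number_pos[OF H]
    by (intro sum_add_card_le) fastforce+
  finally show ?thesis
    using c(1) by simp
qed

lemma total_roman2_domination_number_le_double_domination_number_lex_product:
  assumes G: "pair_graph G" "no_isolated_vertex G"
    and H: "pair_graph H" "pverts H \<noteq> {}" "2 \<le> domination_number H"
  shows "total_roman2_domination_number G \<le> double_domination_number (lex_product G H)"
proof -
  obtain c where c: "double_domination_number (lex_product G H) = sum c (pverts G)"
    "\<And>u. u \<in> pverts G \<Longrightarrow> 2 \<le> sum c (closed_neighbourhood G u)"
    "\<And>u. u \<in> pverts G \<Longrightarrow> sum c (neighbourhood G u) = 0 \<Longrightarrow> domination_number H < c u"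
    using fibre_weight_lex_product[OF G H(1,2)] by metis
  let ?P = "{u \<in> pverts G. 1 \<le> c u}" and ?I = "{u \<in> pverts G. sum c (neighbourhood G u) = 0}"
  obtain J where J: "J \<subseteq> pverts G" "total_dominating_set G (?P \<union> J)" "card J \<le> card ?I"
    by (rule total_dominating_set_extend_support[OF G c(2)])
  \<comment> \<open>Truncation at 2 and the maximum, rather than a sum, keep the values in {0, 1,
    2}, while the support becomes exactly \<open>?P \<union> J\<close>.\<close>
  define f where "f u = max (min 2 (c u)) (if u \<in> J then 1 else 0)" for u
  have "{u \<in> pverts G. 1 \<le> f u} = ?P \<union> J"
    using J(1) by (auto simp: f_def)
  \<comment> \<open>A neighbour with \<open>c w \<ge> 2\<close> retains value 2 and suffices alone.
    Otherwise truncation changes nothing on the open neighbourhood, which carries the full weight 2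
    because \<open>c v = 0\<close>.\<close>
  moreover have "2 \<le> sum f (neighbourhood G v)" if v: "v \<in> pverts G" "f v = 0" for v
  proof (cases "\<exists>w \<in> neighbourhood G v. 2 \<le> c w")
    case True
    then obtain w where w: "w \<in> neighbourhood G v" "2 \<le> f w"
      by (auto simp: f_def)
    then show ?thesis
      using member_le_sum[of w "neighbourhood G v" f] finite_neighbourhood[OF G(1)] by simp
  next
    case False
    have "c v = 0"
      using v(2) by (auto simp: f_def max_def min_def split: if_splits)
    then have "2 \<le> sum c (neighbourhood G v)"
      using c(2)[OF v(1)] finite_neighbourhood[OF G(1)] not_in_neighbourhood_self[OF G(1)]
      by (simp add: closed_neighbourhood_def)
    also have "\<dots> \<le> sum f (neighbourhood G v)"
      using False by (intro sum_mono) (auto simp: f_def)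
    finally show ?thesis .
  qed
  moreover have "f ` pverts G \<subseteq> {0, 1, 2}"
    by (auto simp: f_def max_def min_def)
  ultimately have "total_roman2_dominating_function G f"
    using J(2) unfolding total_roman2_dominating_function_def by simp
  then have "total_roman2_domination_number G \<le> sum f (pverts G)"
    by (rule total_roman2_domination_number_le)
  also have "\<dots> \<le> (\<Sum>u \<in> pverts G. min 2 (c u) + (if u \<in> J then 1 else 0))"
    by (intro sum_mono) (auto simp: f_def)
  also have "\<dots> = (\<Sum>u \<in> pverts G. min 2 (c u)) + card {u \<in> pverts G. u \<in> J}"
    using finite_pverts[OF G(1)] by (simp add: sum.distrib flip: sum.inter_filter)
  also have "{u \<in> pverts G. u \<in> J} = J"
    using J(1) by blast
  also have "(\<Sum>u \<in> pverts G. min 2 (c u)) + card J \<le> (\<Sum>u \<in> pverts G. min 2 (c u)) + card ?I"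
    using J(3) by simp
  \<comment> \<open>With \<open>domination_number H \<ge> 2\<close>, each vertex of
    \<open>?I\<close> has \<open>c u \<ge> 3\<close>. Truncation to 2 frees at least one unit there,
    which pays for the added neighbour.\<close>
  also have "\<dots> \<le> sum c (pverts G)"
    using finite_pverts[OF G(1)] c(3) H(3)
    by (intro sum_add_card_le) fastforce+
  finally show ?thesis
    using c(1) by simp
qed

section \<open>Matching upper and lower bounds\<close>

theorem theorem2p8:
  fixes G :: "'a pair_pre_digraph" and H :: "'b pair_pre_digraph"
  assumes "pair_graph G" and "pverts G \<noteq> {}" and "no_isolated_vertex G"
    and "pair_graph H" and "2 \<le> card (pverts H)"
  shows "(domination_number G = two_packing_number G \<and>
            (\<exists>S. double_dominating_set H S) \<and> double_domination_number H = 2 \<longrightarrow>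
            double_domination_number (lex_product G H) = 2 * domination_number G) \<and>
         (total_roman2_domination_number G
              \<in> {total_domination_number G, 2 * two_packing_number G} \<and>
            domination_number H = 1 \<longrightarrow>
            double_domination_number (lex_product G H) = total_roman2_domination_number G) \<and>
         (total_roman2_domination_number G = 2 * total_domination_number G \<and>
            2 \<le> domination_number H \<longrightarrow>
            double_domination_number (lex_product G H) = total_roman2_domination_number G)"
proof -
  note G = assms(1,3) and H = assms(4)
  have ne: "pverts H \<noteq> {}"
    using assms(5) by auto
  note packing = two_packing_number_le_double_domination_number_lex_product[OF G H ne]
  note total = total_domination_number_le_double_domination_number_lex_product[OF G H ne]
  \<comment> \<open>The value lies between \<open>2 * two_packing_number G\<close> and
    \<open>domination_number G * 2\<close>, which coincide here.\<close>
  have "double_domination_number (lex_product G H) = 2 * domination_number G"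
    if "domination_number G = two_packing_number G" "\<exists>S. double_dominating_set H S"
      "double_domination_number H = 2"
    using double_domination_number_lex_product_le_mult[OF G(1) H that(2)] packing that by simp
  \<comment> \<open>The upper bound is the Roman parameter itself; depending on which of the two
    values it takes, the matching lower bound is \<open>total\<close> or
    \<open>packing\<close>.\<close>
  moreover have "double_domination_number (lex_product G H) = total_roman2_domination_number G"
    if "total_roman2_domination_number G \<in> {total_domination_number G, 2 * two_packing_number G}"
      "domination_number H = 1"
    using double_domination_number_lex_product_le_roman[OF G H assms(5) that(2)] packing total
      that(1) by auto
  \<comment> \<open>The roles are exchanged: the Roman parameter is now the lower bound, and the
    doubled total dominating set gives the upper one.\<close>
  moreover have "double_domination_number (lex_product G H) = total_roman2_domination_number G"
    if "total_roman2_domination_number G = 2 * total_domination_number G"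
      "2 \<le> domination_number H"
    using double_domination_number_lex_product_le_total[OF G H assms(5)] that(1)
      total_roman2_domination_number_le_double_domination_number_lex_product[OF G H ne that(2)]
    by simp
  ultimately show ?thesis
    by blast
qed

end
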